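(* Let $k$ be a positive integer with $k \equiv 12 \pmod{15}$ and let \[ n = L_{CC}(10,k) = \frac{512k^5+1280k^4+6080k^3+7840k^2+10010k+3741}{3125}. \] Then there is an undirected Cayley graph of the cyclic group $\mathbb{Z}_n$ on five generators which has diameter $k$. Moreover, a generating set for such a graph is \[ \Big\{1,\ \tfrac{128k^4+256k^3+1192k^2+1064k+883}{625},\ \tfrac{512k^5+1920k^4+6560k^3+14600k^2+7980k+10431}{9375},\ \tfrac{512k^5+1920k^4+6560k^3+14600k^2+15480k+14181}{9375},\ \tfrac{512k^5+1920k^4+8960k^3+18200k^2+28530k+20106}{9375}\Big\}, \] i.e. the Cayley graph of $\mathbb{Z}_n$ with connection set $\{\pm g_1,\dots,\pm g_5\}$, where $g_1,\dots,g_5$ are these integers taken modulo $n$, has diameter $k$.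
   Context: For a positive integer $n$ and integers $g_1,\dots,g_5$, the undirected Cayley (circulant) graph of the cyclic group $\mathbb{Z}_n$ with generating set $\{g_1,\dots,g_5\}$ has vertex set $\mathbb{Z}_n$, with $i$ and $j$ adjacent if and only if $j-i \equiv \pm g_t \pmod n$ for some $t$. Its diameter is the maximum over pairs of vertices of the graph distance. The notation $L_{CC}(10,k)$ is just a name for the displayed polynomial value. *)

theory Defs
  imports "Graph_Theory.Graph_Theory" "HOL-Number_Theory.Cong"
begin

text \<open>
  As usual in \<^theory>\<open>Graph_Theory.Digraph\<close>, an undirected graph is a symmetric digraph.
  The vertex set of the circulant graph consists of the canonical representatives of the
  residue classes modulo \<open>n\<close>; the generators may be arbitrary integer representatives.
\<close>

definition circulant_graph :: "nat \<Rightarrow> int set \<Rightarrow> int pair_pre_digraph" where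
  "circulant_graph n S =
    \<lparr> pverts = {0..<int n},
      parcs = {(i, j). i \<in> {0..<int n} \<and> j \<in> {0..<int n} \<and>
        (\<exists>g\<in>S. [j - i = g] (mod int n) \<or> [j - i = - g] (mod int n))} \<rparr>"

lemma pair_wf_digraph_circulant_graph: "pair_wf_digraph (circulant_graph n S)"
  by unfold_locales (auto simp: circulant_graph_def)

lemma symmetric_circulant_graph: "symmetric (with_proj (circulant_graph n S))"
proof -
  have "[i - j = - g] (mod int n)" if "[j - i = g] (mod int n)" for i j g :: int
    using that cong_minus_minus_iff[of "j - i" g "int n"] by simp
  moreover have "[i - j = g] (mod int n)" if "[j - i = - g] (mod int n)" for i j g :: int
    using that cong_minus_minus_iff[of "j - i" "- g" "int n"] by simp
  ultimately show ?thesis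
    unfolding symmetric_def sym_def by (fastforce simp: circulant_graph_def)
qed

text \<open>
  The distance is the minimal cost of a walk, with every arc of cost 1; it is \<open>\<infinity>\<close> if there is
  no walk. Hence the diameter of a disconnected graph is \<open>\<infinity>\<close>.
\<close>

definition graph_distance :: "('a, 'b) pre_digraph \<Rightarrow> 'a \<Rightarrow> 'a \<Rightarrow> ereal" where
  "graph_distance G u v = wf_digraph.\<mu> G (\<lambda>_. 1) u v"

definition graph_diameter :: "('a, 'b) pre_digraph \<Rightarrow> ereal" where
  "graph_diameter G = (SUP (u, v)\<in>verts G \<times> verts G. graph_distance G u v)"

text \<open>
  The fractions are taken in the rationals; that their values are integers for
  \<open>k \<equiv> 12 (mod 15)\<close> is part of what is to be shown.
\<close>

definition L_CC_10 :: "nat \<Rightarrow> rat" where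
  "L_CC_10 k = (512 * of_nat k ^ 5 + 1280 * of_nat k ^ 4 + 6080 * of_nat k ^ 3
    + 7840 * of_nat k ^ 2 + 10010 * of_nat k + 3741) / 3125"

definition generators_10 :: "nat \<Rightarrow> rat set" where
  "generators_10 k =
    {1,
     (128 * of_nat k ^ 4 + 256 * of_nat k ^ 3 + 1192 * of_nat k ^ 2
       + 1064 * of_nat k + 883) / 625,
     (512 * of_nat k ^ 5 + 1920 * of_nat k ^ 4 + 6560 * of_nat k ^ 3
       + 14600 * of_nat k ^ 2 + 7980 * of_nat k + 10431) / 9375,
     (512 * of_nat k ^ 5 + 1920 * of_nat k ^ 4 + 6560 * of_nat k ^ 3
       + 14600 * of_nat k ^ 2 + 15480 * of_nat k + 14181) / 9375,
     (512 * of_nat k ^ 5 + 1920 * of_nat k ^ 4 + 8960 * of_nat k ^ 3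
       + 18200 * of_nat k ^ 2 + 28530 * of_nat k + 20106) / 9375}"

end

theory Submission
  imports Defs "HOL-Library.Cardinality"
begin

text \<open>
  Let \<open>A\<close> be a skew-symmetric \<open>N \<times> N\<close> matrix with entries in \<open>{- 1, 0, 1}\<close>, and let \<open>L\<close> be the
  lattice of all \<open>(d I + A)\<^sup>T c / 2\<close> where the entries of \<open>c\<close> have the same parity. For a sign
  vector \<open>s\<close> the lattice vector \<open>v\<^sub>s = (d I + A)\<^sup>T s / 2\<close> has 1-norm \<open>N d / 2\<close>, as \<open>s\<^sup>T A s = 0\<close>.

  Lower bound: pairing \<open>(d I + A)\<^sup>T c\<close> with the signs of \<open>c\<close> shows that no lattice vector with odd
  \<open>c\<close> is shorter than \<open>v\<^sub>s\<close>. Any two lattice vectors that differ by such a vector are therefore far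
  apart, and a point between \<open>0\<close> and \<open>v\<^sub>s\<close> at half the distance is far from all of \<open>L\<close>.

  Upper bound: let \<open>r\<close> be of least norm in its class modulo the sublattice given by even \<open>c\<close>. If
  \<open>r\<close> has sign vector \<open>s\<close> and no zero entry, subtracting \<open>\<plusminus>\<close> the i-th generator of the sublattice
  shortens \<open>r\<close> exactly when \<open>\<bar>r\<^sub>i\<bar> > \<bar>(v\<^sub>s)\<^sub>i\<bar>\<close>. Hence \<open>r\<close> lies in the box spanned by \<open>0\<close> and
  \<open>v\<^sub>s\<close>, so \<open>\<parallel>r\<parallel> + \<parallel>v\<^sub>s - r\<parallel> = N d / 2\<close> and one of the two norms is at most \<open>N d / 4\<close>. Zero
  entries of \<open>r\<close> leave signs to be chosen. When the graph of \<open>A\<close> is a matching joined to a hub, a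
  conflict between the choices would be a combined move that shortens \<open>r\<close>.

  For the theorem, \<open>A\<close> belongs to the bowtie, two directed triangles sharing the hub, and \<open>d = 2 b\<close>
  with \<open>b = (2 k + 1) / 5\<close>. Then \<open>n = det (2 b I + A) / 2\<close>, and \<open>L\<close> is the kernel of
  \<open>x \<mapsto> \<Sum> g\<^sub>i x\<^sub>i\<close> from \<open>\<int>\<^sup>5\<close> to \<open>\<int>\<^sub>n\<close>.
\<close>

section \<open>Distances in circulant graphs\<close>

definition l1_norm :: "('i::finite \<Rightarrow> int) \<Rightarrow> int" where
  "l1_norm x = (\<Sum>i\<in>UNIV. \<bar>x i\<bar>)"

definition lincomb :: "('i::finite \<Rightarrow> int) \<Rightarrow> ('i \<Rightarrow> int) \<Rightarrow> int" where
  "lincomb g y = (\<Sum>i\<in>UNIV. y i * g i)"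

lemma l1_norm_nonneg: "0 \<le> l1_norm x"
  by (simp add: l1_norm_def sum_nonneg)

lemma l1_norm_eq_0_iff: "l1_norm x = 0 \<longleftrightarrow> (\<forall>i. x i = 0)"
  by (simp add: l1_norm_def sum_nonneg_eq_0_iff)

lemma l1_norm_minus_commute: "l1_norm (x - y) = l1_norm (y - x)"
  by (simp add: l1_norm_def abs_minus_commute)

lemma l1_norm_triangle_ineq: "l1_norm x \<le> l1_norm y + l1_norm (x - y)"
  unfolding l1_norm_def sum.distrib[symmetric] by (rule sum_mono) simp

lemma lincomb_diff: "lincomb g (x - y) = lincomb g x - lincomb g y"
  by (simp add: lincomb_def left_diff_distrib sum_subtractf)

lemma sum_fun_upd:
  fixes f :: "'i::finite \<Rightarrow> 'b \<Rightarrow> 'c::ab_group_add"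
  shows "(\<Sum>j\<in>UNIV. f j ((y(i := z)) j)) = (\<Sum>j\<in>UNIV. f j (y j)) - f i (y i) + f i z"
  by (simp add: sum.remove[of UNIV i])

lemma l1_norm_fun_upd: "l1_norm (y(i := z)) = l1_norm y - \<bar>y i\<bar> + \<bar>z\<bar>"
  unfolding l1_norm_def by (rule sum_fun_upd)

lemma lincomb_fun_upd: "lincomb g (y(i := z)) = lincomb g y + (z - y i) * g i"
  unfolding lincomb_def using sum_fun_upd[of "\<lambda>j x. x * g j" y i z] by (simp add: algebra_simps)

lemma circulant_arc_iff:
  "(u, w) \<in> parcs (circulant_graph n (range g)) \<longleftrightarrow>
    u \<in> {0..<int n} \<and> w \<in> {0..<int n} \<and> (\<exists>i \<epsilon>. \<bar>\<epsilon>\<bar> = 1 \<and> [w - u = \<epsilon> * g i] (mod int n))"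
proof -
  have unit: "\<bar>\<epsilon>\<bar> = 1 \<longleftrightarrow> \<epsilon> = 1 \<or> \<epsilon> = - 1" for \<epsilon> :: int by linarith
  show ?thesis unfolding circulant_graph_def unit by fastforce
qed

lemma lincomb_of_circulant_walk:
  assumes "pre_digraph.awalk (with_proj (circulant_graph n (range g))) u p v"
  shows "\<exists>y. l1_norm y \<le> int (length p) \<and> [v - u = lincomb g y] (mod int n)"
proof -
  interpret pair_wf_digraph "circulant_graph n (range g)"
    by (rule pair_wf_digraph_circulant_graph)
  from assms show ?thesis
  proof (induction p arbitrary: u)
    case Nil
    then show ?case
      by (intro exI[of _ "\<lambda>_. 0"]) (auto simp: awalk_Nil_iff l1_norm_def lincomb_def)
  next
    case (Cons e p)
    obtain w where arc: "(u, w) \<in> parcs (circulant_graph n (range g))" and walk: "awalk w p v"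
      using Cons.prems by (cases e) (auto simp: awalk_Cons_iff)
    obtain i \<epsilon> where unit: "\<bar>\<epsilon>\<bar> = 1" and step: "[w - u = \<epsilon> * g i] (mod int n)"
      using arc by (auto simp: circulant_arc_iff)
    obtain y where short: "l1_norm y \<le> int (length p)"
      and rest: "[v - w = lincomb g y] (mod int n)"
      using Cons.IH[OF walk] by blast
    have "l1_norm (y(i := y i + \<epsilon>)) \<le> int (length (e # p))"
      using short unit by (simp add: l1_norm_fun_upd)
    moreover have "[v - u = lincomb g (y(i := y i + \<epsilon>))] (mod int n)"
      using cong_add[OF rest step] by (simp add: lincomb_fun_upd)
    ultimately show ?case by blast
  qed
qed

lemma circulant_walk_of_lincomb:
  assumes "n > 0" and "u \<in> {0..<int n}" and v: "v \<in> {0..<int n}"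
    and "[v - u = lincomb g y] (mod int n)"
  shows "\<exists>p. pre_digraph.awalk (with_proj (circulant_graph n (range g))) u p v \<and>
    int (length p) = l1_norm y"
proof -
  interpret pair_wf_digraph "circulant_graph n (range g)"
    by (rule pair_wf_digraph_circulant_graph)
  from assms(2,4) show ?thesis
  proof (induction "nat (l1_norm y)" arbitrary: u y)
    case 0
    then have norm: "l1_norm y = 0" using l1_norm_nonneg[of y] by simp
    then have "[v - u = 0] (mod int n)"
      using 0(3) by (simp add: l1_norm_eq_0_iff lincomb_def)
    then have "v = u"
      using 0(2) v by (metis atLeastLessThan_iff cong_diff_iff_cong_0 cong_less_imp_eq_int)
    moreover have "u \<in> pverts (circulant_graph n (range g))"
      using 0(2) by (simp add: circulant_graph_def)
    ultimately show ?case using norm by (intro exI[of _ "[]"]) (simp add: awalk_Nil_iff)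
  next
    case (Suc N)
    obtain i where i: "y i \<noteq> 0" using Suc(2) l1_norm_eq_0_iff[of y] by auto
    define y' where "y' = y(i := y i - sgn (y i))"
    define w where "w = (u + sgn (y i) * g i) mod int n"
    have norm: "l1_norm y = l1_norm y' + 1"
      using i by (auto simp: y'_def l1_norm_fun_upd sgn_if)
    have w: "w \<in> {0..<int n}" using \<open>n > 0\<close> by (simp add: w_def)
    have step: "[w - u = sgn (y i) * g i] (mod int n)"
      by (simp add: w_def cong_def mod_diff_left_eq)
    then have "[v - w = lincomb g y'] (mod int n)"
      using cong_diff[OF Suc(4) step] by (simp add: y'_def lincomb_fun_upd)
    moreover have "N = nat (l1_norm y')" using Suc(2) norm by linarith
    ultimately obtain p where p: "awalk w p v" "int (length p) = l1_norm y'"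
      using Suc(1)[of y' w] w by blast
    have "(u, w) \<in> parcs (circulant_graph n (range g))"
      unfolding circulant_arc_iff using Suc(3) w step i by (metis abs_sgn_eq_1)
    then have "awalk u ((u, w) # p) v" using p(1) by (auto simp: awalk_Cons_iff)
    then show ?case using p(2) norm by (intro exI[of _ "(u, w) # p"]) simp
  qed
qed

lemma graph_distance_circulant_eq_INF:
  "graph_distance (with_proj (circulant_graph n S)) u v =
    (INF p\<in>{p. pre_digraph.awalk (with_proj (circulant_graph n S)) u p v}. ereal (real (length p)))"
proof -
  interpret pair_wf_digraph "circulant_graph n S" by (rule pair_wf_digraph_circulant_graph)
  have "awalk_cost (\<lambda>_. 1) p = real (length p)" for p by (induction p) auto
  then show ?thesis by (simp add: graph_distance_def \<mu>_def)
qed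

lemma graph_distance_circulant_le:
  assumes "n > 0" and "u \<in> {0..<int n}" and "v \<in> {0..<int n}"
    and "[v - u = lincomb g y] (mod int n)" and "l1_norm y \<le> int k"
  shows "graph_distance (with_proj (circulant_graph n (range g))) u v \<le> ereal (real k)"
proof -
  obtain p where "pre_digraph.awalk (with_proj (circulant_graph n (range g))) u p v"
    and "int (length p) = l1_norm y"
    using circulant_walk_of_lincomb[OF assms(1-4)] by blast
  then show ?thesis
    unfolding graph_distance_circulant_eq_INF using assms(5) by (intro INF_lower2[of p]) auto
qed

lemma graph_distance_circulant_ge:
  assumes "\<And>y. [v - u = lincomb g y] (mod int n) \<Longrightarrow> int k \<le> l1_norm y"
  shows "ereal (real k) \<le> graph_distance (with_proj (circulant_graph n (range g))) u v"
  unfolding graph_distance_circulant_eq_INF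
proof (rule INF_greatest, clarify)
  fix p assume "pre_digraph.awalk (with_proj (circulant_graph n (range g))) u p v"
  then obtain y where "l1_norm y \<le> int (length p)" "[v - u = lincomb g y] (mod int n)"
    using lincomb_of_circulant_walk by blast
  then show "ereal (real k) \<le> ereal (real (length p))" using assms[of y] by simp
qed

definition has_covering_radius :: "('i::finite \<Rightarrow> int) set \<Rightarrow> int \<Rightarrow> bool" where
  "has_covering_radius L k \<longleftrightarrow>
    (\<forall>x. \<exists>v\<in>L. l1_norm (x - v) \<le> k) \<and> (\<exists>x. \<forall>v\<in>L. k \<le> l1_norm (x - v))"

theorem graph_diameter_circulant:
  fixes g :: "'i::finite \<Rightarrow> int"
  assumes "n > 0" and "1 \<in> range g"
    and radius: "has_covering_radius {v. int n dvd lincomb g v} (int k)"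
  shows "graph_diameter (with_proj (circulant_graph n (range g))) = ereal (real k)"
  unfolding graph_diameter_def
proof (rule antisym)
  let ?G = "with_proj (circulant_graph n (range g))"
  have verts: "verts ?G = {0..<int n}" by (simp add: circulant_graph_def)
  obtain j where j: "g j = 1" using assms(2) by auto
  have "graph_distance ?G u v \<le> ereal (real k)" if "u \<in> {0..<int n}" "v \<in> {0..<int n}" for u v
  proof -
    define x where "x = (\<lambda>_. 0)(j := v - u)"
    have "lincomb g x = v - u" unfolding x_def lincomb_fun_upd using j by (simp add: lincomb_def)
    moreover obtain y where y: "int n dvd lincomb g y" "l1_norm (x - y) \<le> int k"
      using radius unfolding has_covering_radius_def by blast
    ultimately have "[v - u = lincomb g (x - y)] (mod int n)"
      by (simp add: lincomb_diff cong_iff_dvd_diff)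
    then show ?thesis using \<open>n > 0\<close> that y(2) by (intro graph_distance_circulant_le)
  qed
  then show "(SUP (u, v)\<in>verts ?G \<times> verts ?G. graph_distance ?G u v) \<le> ereal (real k)"
    unfolding verts by (auto intro!: SUP_least)
  obtain x where deep: "\<And>v. int n dvd lincomb g v \<Longrightarrow> int k \<le> l1_norm (x - v)"
    using radius unfolding has_covering_radius_def by blast
  have "ereal (real k) \<le> graph_distance ?G 0 (lincomb g x mod int n)"
  proof (rule graph_distance_circulant_ge)
    fix y assume "[lincomb g x mod int n - 0 = lincomb g y] (mod int n)"
    then have "int n dvd lincomb g (x - y)"
      by (simp add: lincomb_diff cong_iff_dvd_diff[symmetric])
    moreover have "x - (x - y) = y" by auto
    ultimately show "int k \<le> l1_norm y" using deep[of "x - y"] by simp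
  qed
  then show "ereal (real k) \<le> (SUP (u, v)\<in>verts ?G \<times> verts ?G. graph_distance ?G u v)"
    unfolding verts using \<open>n > 0\<close>
    by (intro SUP_upper2[of "(0, lincomb g x mod int n)"]) auto
qed

section \<open>Lattices of skew-symmetric sign matrices\<close>

lemma ex_between_l1_norm:
  assumes "int k \<le> l1_norm v"
  shows "\<exists>x. l1_norm x \<le> int k \<and> l1_norm (v - x) \<le> l1_norm v - int k"
  using assms
proof (induction k)
  case 0
  then show ?case by (intro exI[of _ "\<lambda>_. 0"]) (simp add: l1_norm_def)
next
  case (Suc k)
  then obtain x where x: "l1_norm x \<le> int k" "l1_norm (v - x) \<le> l1_norm v - int k"
    by fastforce
  show ?case
  proof (cases "l1_norm (v - x) \<le> l1_norm v - int (Suc k)")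
    case True
    moreover have "l1_norm x \<le> int (Suc k)" using x(1) by simp
    ultimately show ?thesis by blast
  next
    case False
    then obtain i where i: "v i \<noteq> x i"
      using Suc.prems x(2) l1_norm_eq_0_iff[of "v - x"] by force
    define y where "y = x(i := x i + sgn (v i - x i))"
    have "v - y = (v - x)(i := v i - x i - sgn (v i - x i))" by (auto simp: y_def)
    then have "l1_norm (v - y) = l1_norm (v - x) - 1"
      using i by (simp add: l1_norm_fun_upd sgn_if)
    moreover have "l1_norm y \<le> l1_norm x + 1" by (auto simp: y_def l1_norm_fun_upd sgn_if)
    ultimately show ?thesis using x by (intro exI[of _ y] conjI) linarith+
  qed
qed

lemma abs_1_mult_self: "\<bar>x\<bar> = 1 \<Longrightarrow> x * x = (1::int)"
  by (simp add: abs_if split: if_splits)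

locale skew_sign_matrix =
  fixes A :: "'i::finite \<Rightarrow> 'i \<Rightarrow> int"
  assumes skew: "A i j = - A j i" and abs_entry_le: "\<bar>A i j\<bar> \<le> 1"
begin

definition degree :: "'i \<Rightarrow> int" where
  "degree i = (\<Sum>j\<in>UNIV. \<bar>A j i\<bar>)"

definition transpose_mult :: "('i \<Rightarrow> int) \<Rightarrow> 'i \<Rightarrow> int" where
  "transpose_mult c i = (\<Sum>j\<in>UNIV. A j i * c j)"

definition even_vector :: "int \<Rightarrow> ('i \<Rightarrow> int) \<Rightarrow> 'i \<Rightarrow> int" where
  "even_vector d c i = d * c i + transpose_mult c i"

definition odd_vectors :: "int \<Rightarrow> ('i \<Rightarrow> int) set" where
  "odd_vectors d = {v. \<exists>c. (\<forall>i. odd (c i)) \<and> (\<forall>i. 2 * v i = even_vector d c i)}"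

definition skew_lattice :: "int \<Rightarrow> ('i \<Rightarrow> int) set" where
  "skew_lattice d = range (even_vector d) \<union> odd_vectors d"

lemma abs_skew: "\<bar>A i j\<bar> = \<bar>A j i\<bar>"
  using skew[of i j] by simp

lemma degree_eq_row_sum: "degree i = (\<Sum>j\<in>UNIV. \<bar>A i j\<bar>)"
  unfolding degree_def by (intro sum.cong refl abs_skew)

lemma abs_entry: "A i j \<noteq> 0 \<Longrightarrow> \<bar>A i j\<bar> = 1"
  using abs_entry_le[of i j] by linarith

lemma abs_entry_sgn: "A i j \<noteq> 0 \<Longrightarrow> x \<noteq> 0 \<Longrightarrow> \<bar>A i j * sgn x\<bar> = 1"
  using abs_entry[of i j] by (simp add: abs_mult abs_sgn_eq)

lemma odd_vectorsI:
  assumes "\<And>i. odd (c i)" and "\<And>i. 2 * v i = even_vector d c i"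
  shows "v \<in> odd_vectors d"
  using assms unfolding odd_vectors_def by blast

lemma even_vector_diff: "even_vector d (\<lambda>i. c i - c' i) = even_vector d c - even_vector d c'"
  by (simp add: fun_eq_iff even_vector_def transpose_mult_def right_diff_distrib sum_subtractf)

lemma even_vector_double: "even_vector d (\<lambda>i. 2 * c i) = (\<lambda>i. 2 * even_vector d c i)"
  by (simp add: fun_eq_iff even_vector_def transpose_mult_def distrib_left sum_distrib_left
      mult.left_commute)

lemma odd_vectors_diff_even_vector:
  assumes "v \<in> odd_vectors d"
  shows "v - even_vector d c \<in> odd_vectors d"
proof -
  obtain c' where odd: "\<And>i. odd (c' i)" and v: "\<And>i. 2 * v i = even_vector d c' i"
    using assms unfolding odd_vectors_def by blast
  show ?thesis
    by (rule odd_vectorsI[of "\<lambda>i. c' i - 2 * c i"])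
      (simp_all add: odd even_vector_diff even_vector_double v right_diff_distrib)
qed

lemma skew_latticeI:
  assumes parity: "\<And>i. even (c i - z)" and v: "\<And>i. 2 * v i = even_vector d c i"
  shows "v \<in> skew_lattice d"
proof (cases "even z")
  case True
  then have "even (c i)" for i using parity[of i] by simp
  then have c: "c = (\<lambda>i. 2 * (c i div 2))" by simp
  have "2 * v i = 2 * even_vector d (\<lambda>i. c i div 2) i" for i
    unfolding v by (subst c, subst even_vector_double) (rule refl)
  then have "v = even_vector d (\<lambda>i. c i div 2)" by (metis ext mult_cancel_left zero_neq_numeral)
  then show ?thesis by (simp add: skew_lattice_def)
next
  case False
  then have "odd (c i)" for i using parity[of i] by simp
  then have "v \<in> odd_vectors d" using v by (rule odd_vectorsI)
  then show ?thesis by (simp add: skew_lattice_def)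
qed

definition skew_form :: "('i \<Rightarrow> int) \<Rightarrow> ('i \<Rightarrow> int) \<Rightarrow> int" where
  "skew_form x y = (\<Sum>i\<in>UNIV. x i * transpose_mult y i)"

lemma skew_form_eq_sum: "skew_form x y = (\<Sum>i\<in>UNIV. \<Sum>j\<in>UNIV. A j i * x i * y j)"
  by (simp add: skew_form_def transpose_mult_def sum_distrib_left ac_simps)

lemma skew_form_commute: "skew_form x y = - skew_form y x"
proof -
  have "skew_form x y = (\<Sum>i\<in>UNIV. \<Sum>j\<in>UNIV. A i j * x j * y i)"
    unfolding skew_form_eq_sum by (rule sum.swap)
  also have "\<dots> = (\<Sum>i\<in>UNIV. \<Sum>j\<in>UNIV. - (A j i * y i * x j))"
    using skew by (intro sum.cong refl) (metis mult.assoc mult.commute mult_minus_left)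
  finally show ?thesis by (simp add: skew_form_eq_sum sum_negf)
qed

lemma skew_form_self: "skew_form x x = 0"
  using skew_form_commute[of x x] by simp

lemma sum_sign_mult_even_vector:
  "(\<Sum>i\<in>UNIV. s i * even_vector d c i) = d * (\<Sum>i\<in>UNIV. s i * c i) + skew_form s c"
  by (simp add: even_vector_def skew_form_def distrib_left sum.distrib sum_distrib_left ac_simps)

lemma skew_form_sgn_ge:
  assumes nz: "\<And>i. c i \<noteq> 0"
  shows "- (\<Sum>i\<in>UNIV. degree i * (\<bar>c i\<bar> - 1)) \<le> skew_form (\<lambda>i. sgn (c i)) c"
proof -
  define s where "s i = sgn (c i)" for i
  define excess where "excess i = \<bar>c i\<bar> - 1" for i
  have pair: "\<bar>s i * c j - c i * s j\<bar> \<le> excess i + excess j" for i j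
    using nz[of i] nz[of j] by (auto simp: s_def excess_def sgn_if)
  have entry: "- (\<bar>A j i\<bar> * (excess i + excess j)) \<le> A j i * (s i * c j - c i * s j)" for i j
    using mult_left_mono[OF pair[of i j] abs_ge_zero[of "A j i"]]
    unfolding abs_mult[symmetric] by linarith
  have "(\<Sum>i\<in>UNIV. \<Sum>j\<in>UNIV. \<bar>A j i\<bar> * excess j) = (\<Sum>j\<in>UNIV. \<Sum>i\<in>UNIV. \<bar>A j i\<bar> * excess j)"
    by (rule sum.swap)
  also have "\<dots> = (\<Sum>j\<in>UNIV. degree j * excess j)"
    by (simp add: degree_eq_row_sum sum_distrib_right)
  finally have "2 * (\<Sum>i\<in>UNIV. degree i * excess i) =
      (\<Sum>i\<in>UNIV. \<Sum>j\<in>UNIV. \<bar>A j i\<bar> * (excess i + excess j))"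
    by (simp add: distrib_left sum.distrib degree_def sum_distrib_right)
  then have "- (2 * (\<Sum>i\<in>UNIV. degree i * excess i)) =
      (\<Sum>i\<in>UNIV. \<Sum>j\<in>UNIV. - (\<bar>A j i\<bar> * (excess i + excess j)))"
    by (simp only: sum_negf)
  also have "\<dots> \<le> (\<Sum>i\<in>UNIV. \<Sum>j\<in>UNIV. A j i * (s i * c j - c i * s j))"
    by (intro sum_mono entry)
  also have "\<dots> = skew_form s c - skew_form c s"
    by (simp add: skew_form_eq_sum sum_subtractf[symmetric] algebra_simps)
  also have "\<dots> = 2 * skew_form s c" using skew_form_commute[of c s] by simp
  finally show ?thesis unfolding s_def excess_def by simp
qed

lemma odd_vectors_norm_ge:
  assumes v: "v \<in> odd_vectors d" and deg: "\<And>i. degree i \<le> d"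
  shows "int CARD('i) * d \<le> 2 * l1_norm v"
proof -
  obtain c where odd: "\<And>i. odd (c i)" and c: "\<And>i. 2 * v i = even_vector d c i"
    using v unfolding odd_vectors_def by blast
  have nz: "c i \<noteq> 0" for i using odd[of i] by auto
  have "int CARD('i) * d \<le> (\<Sum>i\<in>UNIV. d + (d - degree i) * (\<bar>c i\<bar> - 1))"
    using sum_bounded_below[of UNIV d "\<lambda>i. d + (d - degree i) * (\<bar>c i\<bar> - 1)"] deg nz
    by (simp add: int_one_le_iff_zero_less)
  also have "\<dots> = d * (\<Sum>i\<in>UNIV. \<bar>c i\<bar>) - (\<Sum>i\<in>UNIV. degree i * (\<bar>c i\<bar> - 1))"
    unfolding sum_distrib_left sum_subtractf[symmetric] by (simp add: algebra_simps)
  also have "\<dots> \<le> d * (\<Sum>i\<in>UNIV. \<bar>c i\<bar>) + skew_form (\<lambda>i. sgn (c i)) c"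
    using skew_form_sgn_ge[OF nz] by simp
  also have "\<dots> = (\<Sum>i\<in>UNIV. sgn (c i) * even_vector d c i)"
    by (simp add: sum_sign_mult_even_vector abs_sgn mult.commute)
  also have "\<dots> \<le> (\<Sum>i\<in>UNIV. \<bar>even_vector d c i\<bar>)"
    using nz by (intro sum_mono) (auto simp: sgn_if)
  also have "\<dots> = 2 * l1_norm v"
    by (simp add: l1_norm_def sum_distrib_left c[symmetric] abs_mult)
  finally show ?thesis .
qed

lemma sign_vector_mult_even_vector_nonneg:
  assumes s: "\<And>i. \<bar>s i\<bar> = 1" and deg: "degree i \<le> d"
  shows "0 \<le> s i * even_vector d s i"
proof -
  have "\<bar>transpose_mult s i\<bar> \<le> degree i"
    unfolding transpose_mult_def degree_def
    by (rule order_trans[OF sum_abs]) (simp add: abs_mult s)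
  then have "\<bar>s i * transpose_mult s i\<bar> \<le> d" using deg by (simp add: abs_mult s)
  moreover have "s i * even_vector d s i = d + s i * transpose_mult s i"
    using abs_1_mult_self[OF s, of i] by (simp add: even_vector_def algebra_simps)
  ultimately show ?thesis by linarith
qed

lemma sum_sign_vector_mult_even_vector:
  assumes "\<And>i. \<bar>s i\<bar> = 1"
  shows "(\<Sum>i\<in>UNIV. s i * even_vector d s i) = int CARD('i) * d"
  using abs_1_mult_self[OF assms] by (simp add: sum_sign_mult_even_vector skew_form_self)

lemma sign_vector_half:
  assumes s: "\<And>i. \<bar>s i\<bar> = 1" and parity: "\<And>i. even (d + degree i)"
  obtains v where "v \<in> odd_vectors d" and "\<And>i. 2 * v i = even_vector d s i"
proof -
  have odd: "odd (s i)" for i using s[of i] by (metis dvd_abs_iff odd_one)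
  have "even (\<Sum>j\<in>UNIV. A j i * s j - \<bar>A j i\<bar>)" for i
    using odd by (intro dvd_sum) simp
  then have "even (transpose_mult s i - degree i)" for i
    by (simp add: transpose_mult_def degree_def sum_subtractf)
  then have "even (even_vector d s i)" for i
    using parity[of i] odd[of i] by (simp add: even_vector_def)
  then have "2 * (even_vector d s i div 2) = even_vector d s i" for i by simp
  moreover from this have "(\<lambda>i. even_vector d s i div 2) \<in> odd_vectors d"
    using odd by (intro odd_vectorsI)
  ultimately show thesis by (rule that[rotated])
qed

lemma lincomb_even_vector:
  "lincomb g (even_vector d c) = (\<Sum>j\<in>UNIV. c j * (d * g j + (\<Sum>i\<in>UNIV. A j i * g i)))"
proof -
  have "lincomb g (even_vector d c) =
      (\<Sum>i\<in>UNIV. c i * (d * g i)) + (\<Sum>i\<in>UNIV. \<Sum>j\<in>UNIV. c j * (A j i * g i))"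
    by (simp add: lincomb_def even_vector_def transpose_mult_def distrib_left sum.distrib
        sum_distrib_left ac_simps)
  also have "(\<Sum>i\<in>UNIV. \<Sum>j\<in>UNIV. c j * (A j i * g i)) = (\<Sum>j\<in>UNIV. \<Sum>i\<in>UNIV. c j * (A j i * g i))"
    by (rule sum.swap)
  finally show ?thesis by (simp add: distrib_left sum.distrib sum_distrib_left)
qed

lemma skew_lattice_subset_kernel:
  assumes eigen: "\<And>j. d * g j + (\<Sum>i\<in>UNIV. A j i * g i) = n * t j"
    and even: "even (\<Sum>j\<in>UNIV. t j)" and v: "v \<in> skew_lattice d"
  shows "n dvd lincomb g v"
proof -
  have lincomb: "lincomb g (even_vector d c) = n * (\<Sum>j\<in>UNIV. c j * t j)" for c
    by (simp add: lincomb_even_vector eigen sum_distrib_left mult.left_commute)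
  consider c where "v = even_vector d c"
    | c where "\<And>i. odd (c i)" "\<And>i. 2 * v i = even_vector d c i"
    using v unfolding skew_lattice_def odd_vectors_def by blast
  then show ?thesis
  proof cases
    case 1
    then show ?thesis by (simp add: lincomb)
  next
    case 2
    have "even (\<Sum>j\<in>UNIV. c j * t j - t j)" using 2(1) by (intro dvd_sum) simp
    then obtain q where q: "(\<Sum>j\<in>UNIV. c j * t j) = 2 * q"
      using even by (auto simp: sum_subtractf elim: evenE)
    have "2 * lincomb g v = lincomb g (even_vector d c)"
      by (simp add: lincomb_def sum_distrib_left 2(2)[symmetric] mult.assoc)
    then have "lincomb g v = n * q" by (simp add: lincomb q)
    then show ?thesis by simp
  qed
qed

lemma ex_deep_hole:
  assumes deg: "\<And>i. degree i \<le> d" and parity: "\<And>i. even (d + degree i)"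
  shows "\<exists>x. \<forall>v\<in>skew_lattice d. int CARD('i) * d div 4 \<le> l1_norm (x - v)"
proof -
  define k where "k = int CARD('i) * d div 4"
  obtain v where v: "v \<in> odd_vectors d" and half: "\<And>i. 2 * v i = even_vector d (\<lambda>_. 1) i"
    using sign_vector_half[of "\<lambda>_. 1"] parity by auto
  have "2 * l1_norm v = (\<Sum>i\<in>UNIV. \<bar>even_vector d (\<lambda>_. 1) i\<bar>)"
    by (simp add: l1_norm_def sum_distrib_left half[symmetric] abs_mult)
  also have "\<dots> = int CARD('i) * d"
    using sign_vector_mult_even_vector_nonneg[of "\<lambda>_. 1", OF _ deg]
      sum_sign_vector_mult_even_vector[of "\<lambda>_. 1" d] by simp
  finally have norm: "2 * l1_norm v = int CARD('i) * d" .
  have long: "l1_norm v \<le> l1_norm w" if "w \<in> odd_vectors d" for w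
    using odd_vectors_norm_ge[OF that deg] norm by simp
  have k: "0 \<le> k" "2 * k \<le> l1_norm v" using norm l1_norm_nonneg[of v] by (simp_all add: k_def)
  then obtain x where x: "l1_norm x \<le> k" "l1_norm (v - x) \<le> l1_norm v - k"
    using ex_between_l1_norm[of "nat k" v] by auto
  have "k \<le> l1_norm (x - w)" if w: "w \<in> skew_lattice d" for w
  proof (cases "w \<in> odd_vectors d")
    case True
    have "l1_norm v \<le> l1_norm x + l1_norm (w - x)"
      using long[OF True] l1_norm_triangle_ineq[of w x] by simp
    then show ?thesis using x(1) k(2) by (simp add: l1_norm_minus_commute)
  next
    case False
    then have "v - w \<in> odd_vectors d"
      using w odd_vectors_diff_even_vector[OF v] unfolding skew_lattice_def by blast
    then have "l1_norm v \<le> l1_norm (v - x) + l1_norm ((v - w) - (v - x))"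
      using long[of "v - w"] l1_norm_triangle_ineq[of "v - w" "v - x"] by simp
    moreover have "(v - w) - (v - x) = x - w" by auto
    ultimately show ?thesis using x(2) by simp
  qed
  then show ?thesis unfolding k_def by blast
qed

end

section \<open>Vectors of least norm modulo the even vectors\<close>

locale dominant_skew_matrix = skew_sign_matrix A for A :: "'i::finite \<Rightarrow> 'i \<Rightarrow> int" +
  fixes d :: int
  \<comment> \<open>The bound is attained by the bowtie with \<open>d = 10\<close>, which is needed for \<open>k = 12\<close>.\<close>
  assumes d_gt_1: "1 < d" and degree_le: "3 * degree i \<le> d + 2"
    and parity: "even (d + degree i)"
begin

lemma degree_less: "degree i < d"
  using degree_le[of i] d_gt_1 by linarith

definition reduced :: "('i \<Rightarrow> int) \<Rightarrow> bool" where
  "reduced r \<longleftrightarrow> (\<forall>c. l1_norm r \<le> l1_norm (r - even_vector d c))"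

lemma ex_reduced: "\<exists>c. reduced (x - even_vector d c)"
proof -
  obtain c where "\<And>c'. nat (l1_norm (x - even_vector d c)) \<le> nat (l1_norm (x - even_vector d c'))"
    using ex_has_least_nat[of "\<lambda>_. True" undefined "\<lambda>c. nat (l1_norm (x - even_vector d c))"]
    by blast
  then have least: "l1_norm (x - even_vector d c) \<le> l1_norm (x - even_vector d c')" for c'
    using l1_norm_nonneg by (metis nat_le_eq_zle)
  have "x - even_vector d c - even_vector d c' = x - even_vector d (\<lambda>i. c i + c' i)" for c'
    by (simp add: fun_eq_iff even_vector_def transpose_mult_def distrib_left sum.distrib)
  then have "reduced (x - even_vector d c)" using least by (simp add: reduced_def)
  then show ?thesis by blast
qed

lemma reduced_abs_le:
  assumes "reduced r"
  shows "2 * \<bar>r i\<bar> \<le> d + degree i"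
proof -
  define c where "c = (\<lambda>_. 0)(i := sgn (r i))"
  have c: "transpose_mult c j = A i j * sgn (r i)" for j
    by (simp add: transpose_mult_def c_def sum.remove[of _ i])
  have "l1_norm r \<le> l1_norm (r - even_vector d c)" using assms by (simp add: reduced_def)
  also have "\<dots> = (\<Sum>j\<in>UNIV. \<bar>r j - d * c j - A i j * sgn (r i)\<bar>)"
    by (simp add: l1_norm_def even_vector_def c algebra_simps)
  also have "\<dots> \<le> (\<Sum>j\<in>UNIV. \<bar>r j - d * c j\<bar> + \<bar>A i j\<bar>)"
    by (intro sum_mono) (auto simp: sgn_if)
  also have "\<dots> = (\<Sum>j\<in>UNIV. \<bar>(r(i := r i - d * sgn (r i))) j\<bar>) + degree i"
    unfolding sum.distrib degree_eq_row_sum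
    by (intro arg_cong2[of _ _ _ _ "(+)"] sum.cong) (auto simp: c_def)
  also have "\<dots> = l1_norm r - \<bar>r i\<bar> + \<bar>r i - d * sgn (r i)\<bar> + degree i"
    unfolding l1_norm_def[symmetric] l1_norm_fun_upd ..
  finally have "\<bar>r i\<bar> \<le> \<bar>r i - d * sgn (r i)\<bar> + degree i" by simp
  then show ?thesis using degree_less[of i]
    by (cases "r i" "0 :: int" rule: linorder_cases) auto
qed

text \<open>
  \<open>2 * (\<bar>(v\<^sub>s)\<^sub>i\<bar> - \<bar>r\<^sub>i\<bar>)\<close> without the contribution of the signs \<open>s\<^sub>j\<close> that are free because
  \<open>r\<^sub>j = 0\<close>.
\<close>

definition slack :: "('i \<Rightarrow> int) \<Rightarrow> 'i \<Rightarrow> int" where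
  "slack r i = d - 2 * \<bar>r i\<bar> + sgn (r i) * transpose_mult (\<lambda>j. sgn (r j)) i"

definition sgn_on :: "'i set \<Rightarrow> ('i \<Rightarrow> int) \<Rightarrow> 'i \<Rightarrow> int" where
  "sgn_on U r j = (if j \<in> U then sgn (r j) else 0)"

text \<open>
  Moves \<open>U\<close> for which subtracting the generators with indices in \<open>U\<close>, each with the sign of its
  entry, changes the norm of a reduced \<open>r\<close> additively over \<open>U\<close>, apart from the zero entries of \<open>r\<close>.
\<close>

definition admissible_move :: "('i \<Rightarrow> int) \<Rightarrow> 'i set \<Rightarrow> bool" where
  "admissible_move r U \<longleftrightarrow> (\<forall>j\<in>U. r j \<noteq> 0) \<and>
    (\<forall>j\<in>U. (\<forall>i\<in>U. A j i = 0) \<or> (\<exists>i. r i = 0 \<and> A j i \<noteq> 0)) \<and>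
    (\<forall>j. j \<notin> U \<longrightarrow> r j \<noteq> 0 \<longrightarrow> (\<Sum>i\<in>U. \<bar>A j i\<bar>) \<le> 1)"

lemma transpose_mult_sgn_on: "transpose_mult (sgn_on U r) j = - (\<Sum>i\<in>U. A j i * sgn (r i))"
proof -
  have "transpose_mult (sgn_on U r) j = (\<Sum>i\<in>UNIV. if i \<in> U then A i j * sgn (r i) else 0)"
    unfolding transpose_mult_def sgn_on_def by (intro sum.cong) auto
  also have "\<dots> = (\<Sum>i\<in>U. A i j * sgn (r i))" by (simp add: sum.If_cases)
  also have "\<dots> = (\<Sum>i\<in>U. - (A j i * sgn (r i)))"
    using skew by (intro sum.cong refl) (metis mult_minus_left)
  finally show ?thesis by (simp add: sum_negf)
qed

lemma abs_transpose_mult_sgn_on_le: "\<bar>transpose_mult (sgn_on U r) j\<bar> \<le> (\<Sum>i\<in>U. \<bar>A j i\<bar>)"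
  unfolding transpose_mult_sgn_on abs_minus_cancel
  by (rule order_trans[OF sum_abs sum_mono]) (simp add: abs_mult sgn_if)

lemma admissible_move_abs_add_le:
  assumes red: "reduced r" and move: "admissible_move r U" and j: "j \<in> U"
  shows "\<bar>r j\<bar> + \<bar>transpose_mult (sgn_on U r) j\<bar> \<le> d"
proof (cases "\<forall>i\<in>U. A j i = 0")
  case True
  then show ?thesis
    using abs_transpose_mult_sgn_on_le[of U r j] reduced_abs_le[OF red, of j] degree_less[of j]
    by simp
next
  case False
  then obtain i where i: "r i = 0" "A j i \<noteq> 0" "i \<notin> U"
    using move j unfolding admissible_move_def by blast
  have "(\<Sum>i\<in>insert i U. \<bar>A j i\<bar>) \<le> degree j"
    unfolding degree_eq_row_sum by (intro sum_mono2) auto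
  then have "1 + (\<Sum>i\<in>U. \<bar>A j i\<bar>) \<le> degree j" using i(3) abs_entry[OF i(2)] by simp
  then show ?thesis
    using abs_transpose_mult_sgn_on_le[of U r j] reduced_abs_le[OF red, of j] degree_le[of j]
    by linarith
qed

lemma admissible_move_coordinate:
  assumes red: "reduced r" and move: "admissible_move r U"
  shows "\<bar>r j - even_vector d (sgn_on U r) j\<bar> = \<bar>r j\<bar> + (if j \<in> U then d - 2 * \<bar>r j\<bar> else 0)
    + (if r j = 0 then \<bar>transpose_mult (sgn_on U r) j\<bar> else 0)
    + (2 * sgn_on U r j - sgn (r j)) * transpose_mult (sgn_on U r) j"
proof -
  consider "j \<in> U" "r j \<noteq> 0" | "j \<notin> U" "r j \<noteq> 0" | "j \<notin> U" "r j = 0"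
    using move unfolding admissible_move_def by blast
  then show ?thesis
  proof cases
    case 1
    then show ?thesis
      using admissible_move_abs_add_le[OF red move 1(1)]
      by (cases "r j" "0 :: int" rule: linorder_cases) (auto simp: even_vector_def sgn_on_def)
  next
    case 2
    then have "\<bar>transpose_mult (sgn_on U r) j\<bar> \<le> 1"
      using move abs_transpose_mult_sgn_on_le[of U r j] unfolding admissible_move_def by force
    then show ?thesis
      using 2 by (cases "r j" "0 :: int" rule: linorder_cases)
        (auto simp: even_vector_def sgn_on_def)
  next
    case 3
    then show ?thesis by (simp add: even_vector_def sgn_on_def)
  qed
qed

lemma sum_slack:
  "(\<Sum>i\<in>U. slack r i) = (\<Sum>i\<in>U. d - 2 * \<bar>r i\<bar>) + skew_form (sgn_on U r) (\<lambda>j. sgn (r j))"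
proof -
  have "skew_form (sgn_on U r) (\<lambda>j. sgn (r j)) =
      (\<Sum>i\<in>UNIV. if i \<in> U then sgn (r i) * transpose_mult (\<lambda>j. sgn (r j)) i else 0)"
    unfolding skew_form_def sgn_on_def by (intro sum.cong) auto
  then show ?thesis by (simp add: sum.If_cases slack_def sum.distrib)
qed

lemma reduced_admissible_move:
  assumes red: "reduced r" and move: "admissible_move r U"
  shows "0 \<le> (\<Sum>i\<in>U. slack r i) + (\<Sum>j | r j = 0. \<bar>\<Sum>i\<in>U. A j i * sgn (r i)\<bar>)"
proof -
  let ?\<sigma> = "\<lambda>j. sgn (r j)" and ?c = "sgn_on U r"
  have "l1_norm r \<le> (\<Sum>j\<in>UNIV. \<bar>r j - even_vector d ?c j\<bar>)"
    using red unfolding reduced_def by (simp add: l1_norm_def)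
  also have "\<dots> = l1_norm r + (\<Sum>j\<in>U. d - 2 * \<bar>r j\<bar>)
      + (\<Sum>j | r j = 0. \<bar>transpose_mult ?c j\<bar>) + (2 * skew_form ?c ?c - skew_form ?\<sigma> ?c)"
    unfolding admissible_move_coordinate[OF red move]
    by (simp add: sum.distrib sum_subtractf sum.If_cases l1_norm_def skew_form_def
        sum_distrib_left left_diff_distrib mult.assoc)
  also have "\<dots> = l1_norm r + (\<Sum>i\<in>U. slack r i) + (\<Sum>j | r j = 0. \<bar>transpose_mult ?c j\<bar>)"
    using skew_form_commute[of ?c ?\<sigma>] by (simp add: skew_form_self sum_slack)
  finally show ?thesis by (simp add: transpose_mult_sgn_on)
qed

lemma reduced_singleton_move:
  assumes red: "reduced r" and "r y \<noteq> 0"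
  shows "0 \<le> slack r y + (\<Sum>j | r j = 0. \<bar>A j y\<bar>)"
proof -
  have "A y y = 0" using skew[of y y] by simp
  then have "admissible_move r {y}"
    using assms(2) abs_entry_le by (simp add: admissible_move_def)
  from reduced_admissible_move[OF red this] show ?thesis
    using assms(2) by (simp add: abs_mult abs_sgn_eq)
qed

definition fits :: "('i \<Rightarrow> int) \<Rightarrow> ('i \<Rightarrow> int) \<Rightarrow> bool" where
  "fits r s \<longleftrightarrow> (\<forall>i. \<bar>s i\<bar> = 1 \<and> s i * r i = \<bar>r i\<bar> \<and> 2 * \<bar>r i\<bar> \<le> s i * even_vector d s i)"

lemma fits_norm_add:
  assumes "fits r s" and v: "\<And>i. 2 * v i = even_vector d s i"
  shows "2 * (l1_norm r + l1_norm (r - v)) = int CARD('i) * d"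
proof -
  have s: "\<bar>s i\<bar> = 1" "s i * r i = \<bar>r i\<bar>" "2 * \<bar>r i\<bar> \<le> s i * even_vector d s i" for i
    using assms(1) by (simp_all add: fits_def)
  have "2 * (\<bar>r i\<bar> + \<bar>r i - v i\<bar>) = s i * even_vector d s i" for i
  proof -
    have "2 * \<bar>r i - v i\<bar> = \<bar>2 * r i - 2 * v i\<bar>" by (simp add: abs_if)
    also have "\<dots> = \<bar>s i * (2 * r i - 2 * v i)\<bar>" by (simp add: abs_mult s(1))
    also have "\<dots> = \<bar>2 * \<bar>r i\<bar> - s i * even_vector d s i\<bar>"
      unfolding v using s(2)[of i] by (simp add: right_diff_distrib mult.left_commute)
    finally show ?thesis using s(3)[of i] by simp
  qed
  then have "2 * (l1_norm r + l1_norm (r - v)) = (\<Sum>i\<in>UNIV. s i * even_vector d s i)"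
    by (simp add: l1_norm_def sum.distrib[symmetric] sum_distrib_left)
  then show ?thesis using sum_sign_vector_mult_even_vector[of s d] s(1) by simp
qed

text \<open>The bound \<open>- 1\<close> suffices because the quantity is even.\<close>

lemma fitsI:
  assumes s: "\<And>i. \<bar>s i\<bar> = 1" and sgn: "\<And>i. r i \<noteq> 0 \<Longrightarrow> s i = sgn (r i)"
    and gap: "\<And>i. r i \<noteq> 0 \<Longrightarrow> - 1 \<le> slack r i + (\<Sum>j | r j = 0. A j i * sgn (r i) * s j)"
  shows "fits r s"
  unfolding fits_def
proof (intro allI conjI)
  fix i
  show "\<bar>s i\<bar> = 1" by (rule s)
  show "s i * r i = \<bar>r i\<bar>"
    using sgn[of i] by (cases "r i = 0") (simp_all add: abs_sgn mult.commute)
  show "2 * \<bar>r i\<bar> \<le> s i * even_vector d s i"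
  proof (cases "r i = 0")
    case True
    then show ?thesis
      using sign_vector_mult_even_vector_nonneg[of s i d] s degree_less[of i]
      by (simp add: less_imp_le)
  next
    case False
    have "transpose_mult s i = (\<Sum>j\<in>UNIV. A j i * sgn (r j) + (if r j = 0 then A j i * s j else 0))"
      unfolding transpose_mult_def using sgn by (intro sum.cong) auto
    also have "\<dots> = transpose_mult (\<lambda>j. sgn (r j)) i + (\<Sum>j | r j = 0. A j i * s j)"
      by (simp add: sum.distrib sum.If_cases transpose_mult_def)
    finally have "s i * transpose_mult s i = sgn (r i) * transpose_mult (\<lambda>j. sgn (r j)) i
        + (\<Sum>j | r j = 0. A j i * sgn (r i) * s j)"
      using sgn[OF False] by (simp add: distrib_left sum_distrib_left ac_simps)
    moreover have "s i * even_vector d s i = d + s i * transpose_mult s i"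
      using abs_1_mult_self[OF s, of i] by (simp add: even_vector_def algebra_simps)
    ultimately have "- 1 \<le> s i * even_vector d s i - 2 * \<bar>r i\<bar>"
      using gap[OF False] by (simp add: slack_def)
    moreover obtain v where "\<And>j. 2 * v j = even_vector d s j"
      using sign_vector_half[of s d, OF s parity] by blast
    then have "even (even_vector d s i)" by (metis dvd_triv_left)
    then have "even (s i * even_vector d s i - 2 * \<bar>r i\<bar>)" by simp
    ultimately show ?thesis by presburger
  qed
qed

lemma covering_of_fits:
  assumes fits: "\<And>r. reduced r \<Longrightarrow> \<exists>s. fits r s"
  shows "\<exists>v\<in>skew_lattice d. l1_norm (x - v) \<le> int CARD('i) * d div 4"
proof -
  obtain c where red: "reduced (x - even_vector d c)" using ex_reduced by blast
  obtain s where s: "fits (x - even_vector d c) s" using fits[OF red] by blast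
  obtain v where v: "v \<in> odd_vectors d" "\<And>i. 2 * v i = even_vector d s i"
    using sign_vector_half[OF _ parity, of s] s unfolding fits_def by blast
  define w where "w = v - even_vector d (\<lambda>i. - c i)"
  have w: "x - even_vector d c - v = x - w"
    by (simp add: fun_eq_iff w_def even_vector_def transpose_mult_def sum_negf)
  have "2 * (l1_norm (x - even_vector d c) + l1_norm (x - w)) = int CARD('i) * d"
    using fits_norm_add[OF s v(2)] by (simp only: w)
  moreover have "even_vector d c \<in> skew_lattice d" "w \<in> skew_lattice d"
    using odd_vectors_diff_even_vector[OF v(1)] by (simp_all add: skew_lattice_def w_def)
  moreover have "a \<le> n div 4 \<or> b \<le> n div 4" if "2 * (a + b) = n" for a b n :: int
    using that by presburger
  ultimately show ?thesis by metis
qed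

end

section \<open>The covering radius of windmill lattices\<close>

locale windmill_matrix = dominant_skew_matrix A d for A :: "'i::finite \<Rightarrow> 'i \<Rightarrow> int" and d +
  fixes hub :: 'i
  assumes hub_adjacent: "j \<noteq> hub \<Longrightarrow> A j hub \<noteq> 0"
    and partner_unique: "\<lbrakk>j \<noteq> hub; i \<noteq> hub; i' \<noteq> hub; A j i \<noteq> 0; A j i' \<noteq> 0\<rbrakk> \<Longrightarrow> i = i'"
begin

lemma adjacent_hub: "j \<noteq> hub \<Longrightarrow> A hub j \<noteq> 0"
  using hub_adjacent[of j] skew[of hub j] by simp

lemma sum_rim_eq:
  assumes j: "j \<noteq> hub" "hub \<notin> W" and y: "y \<in> W" "A j y \<noteq> 0"
    and f: "\<And>i. A j i = 0 \<Longrightarrow> f i = 0"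
  shows "(\<Sum>i\<in>W. f i) = (f y :: int)"
proof -
  have "f i = 0" if "i \<in> W - {y}" for i
    using that j y f partner_unique[of j y i] by auto
  then show ?thesis using y(1) by (simp add: sum.remove[of W y])
qed

lemma sum_rim_le_1:
  assumes "j \<noteq> hub" "hub \<notin> W"
  shows "(\<Sum>i\<in>W. \<bar>A j i\<bar>) \<le> 1"
proof (cases "\<exists>y\<in>W. A j y \<noteq> 0")
  case True
  then obtain y where "y \<in> W" "A j y \<noteq> 0" by blast
  from sum_rim_eq[OF assms this, of "\<lambda>i. \<bar>A j i\<bar>"] show ?thesis
    using abs_entry_le[of j y] by simp
qed simp

definition pull :: "'i set \<Rightarrow> ('i \<Rightarrow> int) \<Rightarrow> 'i \<Rightarrow> int" where
  "pull W r j = (\<Sum>i\<in>W. A j i * sgn (r i))"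

lemma abs_pull:
  assumes "j \<noteq> hub" "hub \<notin> W" and nz: "W \<subseteq> {i. r i \<noteq> 0}"
  shows "\<bar>pull W r j\<bar> = (\<Sum>i\<in>W. \<bar>A j i\<bar>)"
proof (cases "\<exists>y\<in>W. A j y \<noteq> 0")
  case True
  then obtain y where y: "y \<in> W" "A j y \<noteq> 0" by blast
  show ?thesis
    using sum_rim_eq[OF assms(1,2) y, of "\<lambda>i. A j i * sgn (r i)"] subsetD[OF nz y(1)]
      sum_rim_eq[OF assms(1,2) y, of "\<lambda>i. \<bar>A j i\<bar>"]
    by (simp add: pull_def abs_mult abs_sgn_eq)
qed (simp add: pull_def)

lemma abs_pull_le_1:
  assumes "j \<noteq> hub" "hub \<notin> W" "W \<subseteq> {i. r i \<noteq> 0}"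
  shows "\<bar>pull W r j\<bar> \<le> 1"
  unfolding abs_pull[of j W r, OF assms] using assms(1,2) by (rule sum_rim_le_1)

lemma pull_mult:
  assumes "j \<noteq> hub" "hub \<notin> W" and y: "y \<in> W" "r y \<noteq> 0"
  shows "A j y * sgn (r y) * pull W r j = \<bar>A j y\<bar>"
proof (cases "A j y = 0")
  case False
  have "(A j y * sgn (r y)) * (A j y * sgn (r y)) = 1"
    using abs_entry_sgn[OF False y(2)] by (rule abs_1_mult_self)
  moreover have "pull W r j = A j y * sgn (r y)"
    using sum_rim_eq[OF assms(1,2) y(1) False, of "\<lambda>i. A j i * sgn (r i)"] by (simp add: pull_def)
  ultimately show ?thesis using abs_entry[OF False] by simp
qed simp

definition rim_slack :: "('i \<Rightarrow> int) \<Rightarrow> 'i \<Rightarrow> int" where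
  "rim_slack r y = slack r y + (\<Sum>j\<in>{j. r j = 0} - {hub}. \<bar>A j y\<bar>)"

lemma sum_zeros_hub:
  fixes f :: "'i \<Rightarrow> int"
  assumes "r hub = (0 :: int)"
  shows "(\<Sum>j | r j = 0. f j) = f hub + (\<Sum>j\<in>{j. r j = 0} - {hub}. f j)"
  using assms by (simp add: sum.remove)

lemma rim_slack_ge:
  assumes "reduced r" and "r hub = 0" and "r y \<noteq> 0"
  shows "- 1 \<le> rim_slack r y"
  using reduced_singleton_move[OF assms(1,3)] abs_entry_le[of hub y]
  unfolding rim_slack_def sum_zeros_hub[of r, OF assms(2)] by linarith

lemma rim_slack_add_nonneg:
  assumes red: "reduced r" and hub: "r hub = 0" and y: "r y \<noteq> 0" "r y' \<noteq> 0"
    and opposite: "A hub y * sgn (r y) + A hub y' * sgn (r y') = 0"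
  shows "0 \<le> rim_slack r y + rim_slack r y'"
proof -
  let ?Z = "{j. r j = 0} - {hub}"
  have "y \<noteq> hub" using y(1) hub by metis
  then have "y \<noteq> y'" using opposite abs_entry_sgn[OF adjacent_hub y(1)] by fastforce
  have "admissible_move r {y, y'}"
    unfolding admissible_move_def
  proof (intro conjI ballI allI impI disjI2)
    show "\<exists>i. r i = 0 \<and> A j i \<noteq> 0" if "j \<in> {y, y'}" for j
      using that y hub hub_adjacent[of j] by blast
    show "(\<Sum>i\<in>{y, y'}. \<bar>A j i\<bar>) \<le> 1" if "r j \<noteq> 0" for j
      using that y hub by (intro sum_rim_le_1) auto
  qed (use y in auto)
  from reduced_admissible_move[OF red this]
  have "0 \<le> slack r y + slack r y' + (\<Sum>j\<in>?Z. \<bar>A j y * sgn (r y) + A j y' * sgn (r y')\<bar>)"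
    using \<open>y \<noteq> y'\<close> opposite by (simp add: sum_zeros_hub[of r, OF hub])
  also have "(\<Sum>j\<in>?Z. \<bar>A j y * sgn (r y) + A j y' * sgn (r y')\<bar>) \<le> (\<Sum>j\<in>?Z. \<bar>A j y\<bar> + \<bar>A j y'\<bar>)"
    by (intro sum_mono) (auto simp: sgn_if)
  finally show ?thesis by (simp add: rim_slack_def sum.distrib)
qed

lemma ex_hub_sign:
  assumes red: "reduced r" and hub: "r hub = 0"
  shows "\<exists>\<epsilon>. \<bar>\<epsilon>\<bar> = 1 \<and> (\<forall>y. r y \<noteq> 0 \<longrightarrow> - 1 \<le> rim_slack r y + A hub y * sgn (r y) * \<epsilon>)"
proof -
  have unit: "\<bar>A hub y * sgn (r y)\<bar> = 1" if "r y \<noteq> 0" for y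
    using that hub by (intro abs_entry_sgn adjacent_hub) auto
  show ?thesis
  proof (cases "\<exists>y. r y \<noteq> 0 \<and> rim_slack r y < 0")
    case True
    then obtain y where y: "r y \<noteq> 0" "rim_slack r y < 0" by blast
    have "- 1 \<le> rim_slack r y' + A hub y' * sgn (r y') * (A hub y * sgn (r y))"
      if y': "r y' \<noteq> 0" for y'
    proof (cases "A hub y' * sgn (r y') = A hub y * sgn (r y)")
      case True
      then show ?thesis
        using rim_slack_ge[OF red hub y'] abs_1_mult_self[OF unit[OF y(1)]] by simp
    next
      case False
      then have "0 \<le> rim_slack r y + rim_slack r y'"
        using unit[OF y(1)] unit[OF y'] by (intro rim_slack_add_nonneg[OF red hub y(1) y']) linarith
      moreover have "\<bar>A hub y' * sgn (r y') * (A hub y * sgn (r y))\<bar> = 1"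
        unfolding abs_mult[of "A hub y' * sgn (r y')"] unit[OF y(1)] unit[OF y'] by simp
      ultimately show ?thesis using y(2) by linarith
    qed
    then show ?thesis using unit[OF y(1)] by blast
  next
    case False
    have "- 1 \<le> rim_slack r y + A hub y * sgn (r y) * 1" if "r y \<noteq> 0" for y
      using False that unit[OF that] by force
    then show ?thesis by (intro exI[of _ 1]) simp
  qed
qed

lemma ex_fits_hub_zero:
  assumes red: "reduced r" and hub: "r hub = 0"
  shows "\<exists>s. fits r s"
proof -
  define p where "p = pull {i. r i \<noteq> 0} r"
  obtain \<epsilon> where \<epsilon>: "\<bar>\<epsilon>\<bar> = 1"
    and hub_sign: "\<And>y. r y \<noteq> 0 \<Longrightarrow> - 1 \<le> rim_slack r y + A hub y * sgn (r y) * \<epsilon>"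
    using ex_hub_sign[OF red hub] by blast
  define s where "s j = (if r j \<noteq> 0 then sgn (r j) else if j = hub then \<epsilon> else
    if p j = 0 then 1 else p j)" for j
  have "fits r s"
  proof (rule fitsI)
    fix i
    have "\<bar>p i\<bar> \<le> 1" if "i \<noteq> hub"
      unfolding p_def using that hub by (intro abs_pull_le_1) simp_all
    then show "\<bar>s i\<bar> = 1" using \<epsilon> by (auto simp: s_def abs_sgn_eq)
    show "s i = sgn (r i)" if "r i \<noteq> 0" using that by (simp add: s_def)
  next
    fix y assume y: "r y \<noteq> 0"
    have "A j y * sgn (r y) * s j = \<bar>A j y\<bar>" if j: "j \<in> {j. r j = 0} - {hub}" for j
      using pull_mult[of j "{i. r i \<noteq> 0}" y r] j y hub by (auto simp: s_def p_def)
    then have "(\<Sum>j | r j = 0. A j y * sgn (r y) * s j) =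
        A hub y * sgn (r y) * \<epsilon> + (\<Sum>j\<in>{j. r j = 0} - {hub}. \<bar>A j y\<bar>)"
      using hub by (simp add: sum_zeros_hub s_def)
    then show "- 1 \<le> slack r y + (\<Sum>j | r j = 0. A j y * sgn (r y) * s j)"
      using hub_sign[OF y] by (simp add: rim_slack_def)
  qed
  then show ?thesis by blast
qed

text \<open>
  Vertices whose box condition fails unless the sign at their unique zero neighbour other than the
  hub is the one they pull it to.
\<close>

definition forced :: "('i \<Rightarrow> int) \<Rightarrow> 'i set" where
  "forced r = {y. y \<noteq> hub \<and> r y \<noteq> 0 \<and> slack r y < 0}"

lemma forced_zero_partner:
  assumes red: "reduced r" and y: "y \<in> forced r"
  obtains j where "r j = 0" and "A y j \<noteq> 0"
proof -
  have "(\<Sum>j | r j = 0. \<bar>A j y\<bar>) \<noteq> 0"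
    using reduced_singleton_move[OF red, of y] y by (simp add: forced_def)
  then obtain j where "j \<in> {j. r j = 0}" "\<bar>A j y\<bar> \<noteq> 0"
    by (rule sum.not_neutral_contains_not_neutral)
  then show thesis using that[of j] skew[of j y] by simp
qed

lemma admissible_forced_move:
  assumes red: "reduced r" and hub: "r hub \<noteq> 0"
  shows "admissible_move r (insert hub (forced r))"
  unfolding admissible_move_def
proof (intro conjI ballI allI impI)
  fix j assume j: "j \<in> insert hub (forced r)"
  then show "r j \<noteq> 0" using hub by (auto simp: forced_def)
  show "(\<forall>i\<in>insert hub (forced r). A j i = 0) \<or> (\<exists>i. r i = 0 \<and> A j i \<noteq> 0)"
  proof (cases "j = hub")
    case True
    moreover have "A hub hub = 0" using skew[of hub hub] by simp
    moreover have "\<exists>i. r i = 0 \<and> A hub i \<noteq> 0" if "y \<in> forced r" for y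
      using forced_zero_partner[OF red that] adjacent_hub hub by metis
    ultimately show ?thesis by blast
  next
    case False
    then show ?thesis using j forced_zero_partner[OF red, of j] by blast
  qed
next
  fix j assume j: "j \<notin> insert hub (forced r)" "r j \<noteq> 0"
  have "A j y = 0" if y: "y \<in> forced r" for y
  proof -
    obtain i where "r i = 0" "A y i \<noteq> 0" using forced_zero_partner[OF red y] .
    then have "A y j = 0" using partner_unique[of y i j] y j hub by (auto simp: forced_def)
    then show ?thesis using skew[of j y] by simp
  qed
  then show "(\<Sum>i\<in>insert hub (forced r). \<bar>A j i\<bar>) \<le> 1"
    using abs_entry_le[of j hub] by (simp add: forced_def)
qed

definition zero_sign :: "('i \<Rightarrow> int) \<Rightarrow> 'i \<Rightarrow> int" where
  "zero_sign r j = (if pull (forced r) r j = 0 then A j hub * sgn (r hub) else pull (forced r) r j)"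

lemma forced_subset: "hub \<notin> forced r" "forced r \<subseteq> {i. r i \<noteq> 0}"
  by (auto simp: forced_def)

lemma sum_zeros_le_1:
  assumes "r hub \<noteq> (0 :: int)" and "y \<noteq> hub"
  shows "(\<Sum>j | r j = 0. \<bar>A j y\<bar>) \<le> 1"
  using sum_rim_le_1[OF assms(2), of "{j. r j = 0}"] assms(1) unfolding abs_skew[of y] by simp

lemma abs_zero_sign:
  assumes "j \<noteq> hub" and "r hub \<noteq> 0"
  shows "\<bar>zero_sign r j\<bar> = 1"
proof -
  have "\<bar>A j hub * sgn (r hub)\<bar> = 1"
    using assms hub_adjacent by (intro abs_entry_sgn)
  moreover have "\<bar>pull (forced r) r j\<bar> \<le> 1"
    using assms(1) forced_subset by (rule abs_pull_le_1)
  ultimately show ?thesis unfolding zero_sign_def by (simp split: if_split) linarith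
qed

lemma zero_sign_rim_gap:
  assumes red: "reduced r" and hub: "r hub \<noteq> 0" and y: "y \<noteq> hub" "r y \<noteq> 0"
  shows "- 1 \<le> slack r y + (\<Sum>j | r j = 0. A j y * sgn (r y) * zero_sign r j)"
proof (cases "y \<in> forced r")
  case True
  have "A j y * sgn (r y) * zero_sign r j = \<bar>A j y\<bar>" if "r j = 0" for j
  proof -
    have "j \<noteq> hub" using that hub by blast
    from pull_mult[of j "forced r" y r, OF this forced_subset(1) True y(2)] show ?thesis
      by (auto simp: zero_sign_def)
  qed
  then show ?thesis using reduced_singleton_move[OF red y(2)] by simp
next
  case False
  have "- (\<Sum>j | r j = 0. \<bar>A j y\<bar>) = (\<Sum>j | r j = 0. - \<bar>A j y\<bar>)" by (simp add: sum_negf)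
  also have "\<dots> \<le> (\<Sum>j | r j = 0. A j y * sgn (r y) * zero_sign r j)"
  proof (rule sum_mono)
    fix j assume "j \<in> {j. r j = 0}"
    then have "\<bar>zero_sign r j\<bar> = 1" using hub by (intro abs_zero_sign) auto
    then have "\<bar>A j y * sgn (r y) * zero_sign r j\<bar> = \<bar>A j y\<bar>"
      using y(2) by (simp add: abs_mult abs_sgn_eq)
    then show "- \<bar>A j y\<bar> \<le> A j y * sgn (r y) * zero_sign r j" by linarith
  qed
  finally show ?thesis
    using False y sum_zeros_le_1[of r, OF hub y(1)] by (simp add: forced_def)
qed

lemma zero_sign_hub_gap:
  assumes red: "reduced r" and hub: "r hub \<noteq> 0"
  shows "0 \<le> slack r hub + (\<Sum>j | r j = 0. A j hub * sgn (r hub) * zero_sign r j)"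
proof -
  let ?p = "pull (forced r) r"
  have rim: "j \<noteq> hub" if "r j = 0" for j using that hub by blast
  have "0 \<le> slack r hub + (\<Sum>y\<in>forced r. slack r y)
      + (\<Sum>j | r j = 0. \<bar>A j hub * sgn (r hub) + ?p j\<bar>)"
    using reduced_admissible_move[OF red admissible_forced_move[OF red hub]]
    by (simp add: forced_subset pull_def)
  also have "(\<Sum>y\<in>forced r. slack r y) \<le> (\<Sum>y\<in>forced r. - (\<Sum>j | r j = 0. \<bar>A j y\<bar>))"
  proof (rule sum_mono)
    fix y assume "y \<in> forced r"
    then show "slack r y \<le> - (\<Sum>j | r j = 0. \<bar>A j y\<bar>)"
      using sum_zeros_le_1[of r y, OF hub] by (simp add: forced_def)
  qed
  also have "\<dots> = - (\<Sum>j | r j = 0. \<Sum>y\<in>forced r. \<bar>A j y\<bar>)"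
    unfolding sum_negf by (subst sum.swap) (rule refl)
  also have "\<dots> = - (\<Sum>j | r j = 0. \<bar>?p j\<bar>)"
    by (simp add: abs_pull[OF rim forced_subset])
  finally have "0 \<le> slack r hub + (\<Sum>j | r j = 0. \<bar>A j hub * sgn (r hub) + ?p j\<bar> - \<bar>?p j\<bar>)"
    by (simp add: sum_subtractf)
  also have "\<dots> \<le> slack r hub + (\<Sum>j | r j = 0. A j hub * sgn (r hub) * zero_sign r j)"
  proof (intro add_left_mono sum_mono)
    fix j assume "j \<in> {j. r j = 0}"
    then have j: "j \<noteq> hub" using hub by auto
    have "\<bar>A j hub * sgn (r hub)\<bar> = 1" using j hub hub_adjacent by (intro abs_entry_sgn)
    moreover have "\<bar>?p j\<bar> \<le> 1" using j forced_subset by (rule abs_pull_le_1)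
    moreover have "\<bar>x + z\<bar> - \<bar>z\<bar> \<le> x * (if z = 0 then x else z)"
      if "\<bar>x\<bar> = 1" "\<bar>z\<bar> \<le> 1" for x z :: int
    proof -
      have "x \<in> {1, - 1}" "z \<in> {0, 1, - 1}" using that by auto
      then show ?thesis by auto
    qed
    ultimately show
      "\<bar>A j hub * sgn (r hub) + ?p j\<bar> - \<bar>?p j\<bar> \<le> A j hub * sgn (r hub) * zero_sign r j"
      unfolding zero_sign_def by blast
  qed
  finally show ?thesis .
qed

lemma ex_fits_hub_nonzero:
  assumes red: "reduced r" and hub: "r hub \<noteq> 0"
  shows "\<exists>s. fits r s"
proof -
  define s where "s j = (if r j = 0 then zero_sign r j else sgn (r j))" for j
  have "fits r s"
  proof (rule fitsI)
    fix i
    show "\<bar>s i\<bar> = 1" using abs_zero_sign[of i r] hub by (auto simp: s_def abs_sgn_eq)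
    show "s i = sgn (r i)" if "r i \<noteq> 0" using that by (simp add: s_def)
    show "- 1 \<le> slack r i + (\<Sum>j | r j = 0. A j i * sgn (r i) * s j)" if "r i \<noteq> 0"
      using zero_sign_hub_gap[OF red hub] zero_sign_rim_gap[OF red hub _ that]
      by (cases "i = hub") (simp_all add: s_def)
  qed
  then show ?thesis by blast
qed

theorem covering_radius_skew_lattice:
  "has_covering_radius (skew_lattice d) (int CARD('i) * d div 4)"
  unfolding has_covering_radius_def
proof (intro conjI allI)
  show "\<exists>v\<in>skew_lattice d. l1_norm (x - v) \<le> int CARD('i) * d div 4" for x
    using ex_fits_hub_zero ex_fits_hub_nonzero by (intro covering_of_fits) blast
  show "\<exists>x. \<forall>v\<in>skew_lattice d. int CARD('i) * d div 4 \<le> l1_norm (x - v)"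
    using degree_less parity by (intro ex_deep_hole) (simp_all add: less_imp_le)
qed

end

section \<open>The bowtie lattice\<close>

datatype bowtie = Hub | Left1 | Left2 | Right1 | Right2

lemma UNIV_bowtie: "UNIV = {Hub, Left1, Left2, Right1, Right2}"
  using bowtie.exhaust by blast

instance bowtie :: finite
  by standard (simp add: UNIV_bowtie)

lemma sum_bowtie:
  "(\<Sum>i\<in>UNIV. f i) = f Hub + f Left1 + f Left2 + f Right1 + f Right2" for f :: "bowtie \<Rightarrow> int"
  by (simp add: UNIV_bowtie add.assoc)

definition bowtie_arcs :: "(bowtie \<times> bowtie) set" where
  "bowtie_arcs = {(Hub, Left1), (Left1, Left2), (Left2, Hub),
    (Hub, Right1), (Right1, Right2), (Right2, Hub)}"

definition bowtie_matrix :: "bowtie \<Rightarrow> bowtie \<Rightarrow> int" where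
  "bowtie_matrix i j = of_bool ((i, j) \<in> bowtie_arcs) - of_bool ((j, i) \<in> bowtie_arcs)"

interpretation bowtie: skew_sign_matrix bowtie_matrix
  by standard (auto simp: bowtie_matrix_def)

lemma bowtie_matrix_mult:
  "(\<Sum>i\<in>UNIV. bowtie_matrix Hub i * f i) = f Left1 - f Left2 + f Right1 - f Right2"
  "(\<Sum>i\<in>UNIV. bowtie_matrix Left1 i * f i) = f Left2 - f Hub"
  "(\<Sum>i\<in>UNIV. bowtie_matrix Left2 i * f i) = f Hub - f Left1"
  "(\<Sum>i\<in>UNIV. bowtie_matrix Right1 i * f i) = f Right2 - f Hub"
  "(\<Sum>i\<in>UNIV. bowtie_matrix Right2 i * f i) = f Hub - f Right1"
  by (simp_all add: sum_bowtie bowtie_matrix_def bowtie_arcs_def)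

lemma bowtie_transpose_mult:
  "bowtie.transpose_mult c i = - (\<Sum>j\<in>UNIV. bowtie_matrix i j * c j)"
  unfolding bowtie.transpose_mult_def bowtie.skew[of _ i] by (simp add: sum_negf)

lemma bowtie_degree: "bowtie.degree i = (if i = Hub then 4 else 2)"
  by (cases i) (simp_all add: bowtie.degree_def sum_bowtie bowtie_matrix_def bowtie_arcs_def)

lemma windmill_bowtie:
  assumes "5 \<le> b"
  shows "windmill_matrix bowtie_matrix (2 * b) Hub"
proof
  show "bowtie_matrix j Hub \<noteq> 0" if "j \<noteq> Hub" for j
    using that by (cases j) (simp_all add: bowtie_matrix_def bowtie_arcs_def)
  show "i = i'" if "j \<noteq> Hub" "i \<noteq> Hub" "i' \<noteq> Hub" "bowtie_matrix j i \<noteq> 0" "bowtie_matrix j i' \<noteq> 0"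
    for i i' j
    using that by (cases j; cases i; cases i') (simp_all add: bowtie_matrix_def bowtie_arcs_def)
qed (use assms in \<open>simp_all add: bowtie_degree\<close>)

definition bowtie_order :: "int \<Rightarrow> int" where
  "bowtie_order b = 16 * b ^ 5 + 24 * b ^ 3 + 5 * b"

definition base_gen :: "int \<Rightarrow> int \<Rightarrow> int" where
  "base_gen b t = t * (8 * b ^ 4 - 4 * b ^ 3 + 14 * b ^ 2 - 7 * b + 6) - 3"

fun bowtie_gen :: "int \<Rightarrow> int \<Rightarrow> bowtie \<Rightarrow> int" where
  "bowtie_gen b t Left1 = 1"
| "bowtie_gen b t Right1 = 8 * b ^ 4 + 10 * b ^ 2 + 1"
| "bowtie_gen b t Left2 = base_gen b t"
| "bowtie_gen b t Hub = base_gen b t + 2 * b"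
| "bowtie_gen b t Right2 = base_gen b t + 4 * b ^ 3 + 5 * b"

fun bowtie_quotient :: "int \<Rightarrow> bowtie \<Rightarrow> int" where
  "bowtie_quotient t Left1 = 0"
| "bowtie_quotient t Right1 = 1"
| "bowtie_quotient t Left2 = t"
| "bowtie_quotient t Hub = t - 1"
| "bowtie_quotient t Right2 = t"

lemma bowtie_matrix_mult_gen:
  assumes t: "3 * t = 2 * b + 2"
  shows "2 * b * bowtie_gen b t j + (\<Sum>i\<in>UNIV. bowtie_matrix j i * bowtie_gen b t i) =
    bowtie_order b * bowtie_quotient t j"
proof -
  note defs = bowtie_matrix_mult bowtie_gen.simps bowtie_quotient.simps
    base_gen_def bowtie_order_def
  show ?thesis
  proof (cases j)
    case Hub
    show ?thesis unfolding Hub defs using t by algebra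
  next
    case Left1
    show ?thesis unfolding Left1 defs by simp
  next
    case Left2
    show ?thesis unfolding Left2 defs using t by algebra
  next
    case Right1
    show ?thesis unfolding Right1 defs by algebra
  next
    case Right2
    show ?thesis unfolding Right2 defs using t by algebra
  qed
qed

text \<open>
  The coefficient vector of a kernel vector \<open>v\<close>, found by inverting \<open>x I + A\<close>, \<open>x = 2 b\<close>;
  \<open>v Left1\<close> has been eliminated in favour of the quotient \<open>T\<close> of \<open>\<Sum> g\<^sub>i v\<^sub>i\<close> by the order.
\<close>

fun bowtie_coeff :: "int \<Rightarrow> int \<Rightarrow> (bowtie \<Rightarrow> int) \<Rightarrow> int \<Rightarrow> bowtie \<Rightarrow> int" where
  "bowtie_coeff x t v T Left1 = (x ^ 4 + 4 * x ^ 2 + 1) * T - (x ^ 3 + 3 * x) * v Right1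
    + (2 * x + 2 - t * (x ^ 3 - x ^ 2 + 5 * x + 1)) * (v Left2 + v Hub + v Right2)
    - 2 * v Hub - (x ^ 2 + 3) * v Right2"
| "bowtie_coeff x t v T Left2 = (- (x ^ 3) + x ^ 2 - 3 * x + 1) * T + (x ^ 2 - x + 2) * v Right1
    + (t * (x ^ 2 - 2 * x + 5) - 2) * (v Left2 + v Hub + v Right2) + (x - 1) * v Right2"
| "bowtie_coeff x t v T Right1 = (1 - x ^ 2) * T + x * v Right1
    + t * (x - 1) * (v Left2 + v Hub + v Right2) + v Right2"
| "bowtie_coeff x t v T Right2 = (x + 1) ^ 2 * T - (x + 2) * v Right1
    - t * (x + 1) * (v Left2 + v Hub + v Right2) - v Right2"
| "bowtie_coeff x t v T Hub = (x ^ 2 + 1) * (x + 1) * T - x * (x + 1) * v Right1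
    - t * (x ^ 2 + 1) * (v Left2 + v Hub + v Right2) - (x + 1) * v Right2"

lemma even_vector_bowtie_coeff:
  assumes t: "3 * t = 2 * b + 2" and T: "lincomb (bowtie_gen b t) v = bowtie_order b * T"
  shows "2 * v i = bowtie.even_vector (2 * b) (bowtie_coeff (2 * b) t v T) i"
proof -
  note defs = bowtie.even_vector_def bowtie_transpose_mult bowtie_matrix_mult bowtie_coeff.simps
  have v: "v Left1 = bowtie_order b * T - v Hub * bowtie_gen b t Hub
      - v Left2 * bowtie_gen b t Left2 - v Right1 * bowtie_gen b t Right1
      - v Right2 * bowtie_gen b t Right2"
    using T by (simp add: lincomb_def sum_bowtie)
  show ?thesis
  proof (cases i)
    case Hub
    show ?thesis unfolding Hub defs using t by algebra
  next
    case Left1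
    show ?thesis
      unfolding Left1 defs v bowtie_gen.simps base_gen_def bowtie_order_def using t by algebra
  next
    case Left2
    show ?thesis unfolding Left2 defs by algebra
  next
    case Right1
    show ?thesis unfolding Right1 defs by algebra
  next
    case Right2
    show ?thesis unfolding Right2 defs by algebra
  qed
qed

lemma skew_lattice_bowtie:
  assumes t: "3 * t = 2 * b + 2"
  shows "bowtie.skew_lattice (2 * b) = {v. bowtie_order b dvd lincomb (bowtie_gen b t) v}"
proof (intro set_eqI iffI; unfold mem_Collect_eq)
  fix v assume "v \<in> bowtie.skew_lattice (2 * b)"
  moreover have "(\<Sum>j\<in>UNIV. bowtie_quotient t j) = 2 * (b + 1)" using t by (simp add: sum_bowtie)
  then have "even (\<Sum>j\<in>UNIV. bowtie_quotient t j)" by simp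
  ultimately show "bowtie_order b dvd lincomb (bowtie_gen b t) v"
    by (intro bowtie.skew_lattice_subset_kernel[OF bowtie_matrix_mult_gen[OF t]])
next
  fix v assume "bowtie_order b dvd lincomb (bowtie_gen b t) v"
  then obtain T where T: "lincomb (bowtie_gen b t) v = bowtie_order b * T" by (elim dvdE)
  have "even t" using t by presburger
  then have "even (bowtie_coeff (2 * b) t v T i - (T + v Right2))" for i
    by (cases i) simp_all
  then show "v \<in> bowtie.skew_lattice (2 * b)"
    using even_vector_bowtie_coeff[OF t T] by (rule bowtie.skew_latticeI)
qed

section \<open>The circulant graphs\<close>

lemma bowtie_gen_less:
  assumes b: "5 \<le> b" and t: "3 * t = 2 * b + 2"
  shows "bowtie_gen b t Left1 < bowtie_gen b t Right1" (is ?A)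
    and "bowtie_gen b t Right1 < bowtie_gen b t Left2" (is ?B)
    and "bowtie_gen b t Left2 < bowtie_gen b t Hub" (is ?C)
    and "bowtie_gen b t Hub < bowtie_gen b t Right2" (is ?D)
    and "bowtie_gen b t Right2 < bowtie_order b" (is ?E)
proof -
  have "\<exists>u. b = 3 * u + 5 \<and> t = 2 * u + 4" using t by presburger
  then obtain u where u: "b = 3 * u + 5" "t = 2 * u + 4" by blast
  then have "0 \<le> u" using b by simp
  then show ?A ?B ?C ?D ?E
    by (simp_all add: u bowtie_order_def base_gen_def power_numeral_reduce algebra_simps
        add_pos_nonneg)
qed

theorem graph_diameter_bowtie_circulant:
  assumes b: "5 \<le> b" and t: "3 * t = 2 * b + 2"
  shows "graph_diameter
      (with_proj (circulant_graph (nat (bowtie_order b)) (range (bowtie_gen b t)))) =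
    ereal (real (nat (5 * b div 2)))"
proof -
  interpret windmill_matrix bowtie_matrix "2 * b" Hub by (rule windmill_bowtie[OF b])
  have pos: "0 < bowtie_order b" using bowtie_gen_less[OF b t] by simp
  have "has_covering_radius {v. bowtie_order b dvd lincomb (bowtie_gen b t) v} (5 * (2 * b) div 4)"
    using covering_radius_skew_lattice by (simp add: skew_lattice_bowtie[OF t] UNIV_bowtie)
  moreover have "5 * (2 * b) div 4 = int (nat (5 * b div 2))" using b by simp
  ultimately show ?thesis
    using pos by (intro graph_diameter_circulant) (auto simp: image_iff intro: exI[of _ Left1])
qed

lemma of_int_bowtie_order:
  assumes "k = 15 * m + 12"
  shows "of_int (bowtie_order (6 * int m + 5)) = L_CC_10 k"
  unfolding bowtie_order_def L_CC_10_def assms by (simp add: field_simps power_numeral_reduce)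

lemma range_bowtie_gen:
  "range (bowtie_gen b t) = {1, bowtie_gen b t Right1, bowtie_gen b t Left2, bowtie_gen b t Hub,
    bowtie_gen b t Right2}"
  by (auto simp: UNIV_bowtie)

lemma of_int_range_bowtie_gen:
  assumes "k = 15 * m + 12"
  shows "of_int ` range (bowtie_gen (6 * int m + 5) (4 * int m + 4)) = generators_10 k"
  unfolding range_bowtie_gen generators_10_def image_insert image_empty assms
  by (intro arg_cong2[of _ _ _ _ insert] refl)
    (simp_all add: base_gen_def field_simps power_numeral_reduce)

theorem theorem7:
  fixes k :: nat
  assumes "k > 0" and "[k = 12] (mod 15)"
  shows "\<exists>n :: nat. of_nat n = L_CC_10 k \<and>
    (\<exists>S. S \<subseteq> {0..<int n} \<and> card S = 5 \<and>
      graph_diameter (with_proj (circulant_graph n S)) = ereal (real k)) \<and>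
    (\<exists>X :: int set. of_int ` X = generators_10 k \<and>
      card ((\<lambda>g. g mod int n) ` X) = 5 \<and>
      graph_diameter (with_proj (circulant_graph n X)) = ereal (real k))"
proof -
  have "k mod 15 = 12" using assms(2) by (simp add: cong_def)
  then obtain m where k: "k = 15 * m + 12" by (metis mult_div_mod_eq)
  define b t where "b = 6 * int m + 5" and "t = 4 * int m + 4"
  have b: "5 \<le> b" and t: "3 * t = 2 * b + 2" by (simp_all add: b_def t_def)
  define n S where "n = nat (bowtie_order b)" and "S = range (bowtie_gen b t)"
  have n: "int n = bowtie_order b" using bowtie_gen_less[OF b t] by (simp add: n_def)
  have range: "S \<subseteq> {0..<int n}" and card: "card S = 5"
    using bowtie_gen_less[OF b t] by (auto simp: S_def range_bowtie_gen n)
  have "of_nat n = (of_int (int n) :: rat)" by simp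
  also have "\<dots> = L_CC_10 k" unfolding n b_def by (rule of_int_bowtie_order[OF k])
  finally have order: "of_nat n = L_CC_10 k" .
  have gens: "of_int ` S = generators_10 k"
    unfolding S_def b_def t_def by (rule of_int_range_bowtie_gen[OF k])
  have "nat (5 * b div 2) = k" by (simp add: b_def k)
  then have "graph_diameter (with_proj (circulant_graph n S)) = ereal (real k)"
    using graph_diameter_bowtie_circulant[OF b t] by (simp add: n_def S_def)
  moreover have "(\<lambda>g. g mod int n) ` S = S" using range by (force simp: image_iff)
  ultimately show ?thesis using order gens range card by metis
qed

end
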